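(* For $a_0,a_1,b_0,b_1,b_2\in(0,\infty)$, let $a(x)=a_0(x+a_1)$ and $b(x)=b_0(x+b_1)(x+b_2)$, $x\in\mathbb{R}_+$. If $b_1\le a_1\le b_2$, then $\big\{\frac{1}{b(m)+a(m)n}\big\}_{m,n\in\mathbb{Z}_+}$ is joint completely monotone. Conversely, if $\big\{\frac{1}{b(m)+a(m)n}\big\}_{m,n\in\mathbb{Z}_+}$ is joint completely monotone, then $\frac1{a_1}\le\frac1{b_1}+\frac1{b_2}$.
   Context: $\mathbb{Z}_+$ is the set of nonnegative integers and $\mathbb{R}_+$ the set of nonnegative reals. For a real net $\{u_{m,n}\}_{m,n\in\mathbb{Z}_+}$ put $\triangle_1u_{m,n}=u_{m+1,n}-u_{m,n}$ and $\triangle_2u_{m,n}=u_{m,n+1}-u_{m,n}$. The net is joint completely monotone if $(-1)^{i+j}\triangle_1^i\triangle_2^j u_{m,n}\ge 0$ for all $i,j,m,n\in\mathbb{Z}_+$. *)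

theory Defs
  imports Complex_Main
begin

definition diff1 :: "(nat \<Rightarrow> nat \<Rightarrow> real) \<Rightarrow> nat \<Rightarrow> nat \<Rightarrow> real" where
  "diff1 u = (\<lambda>m n. u (m + 1) n - u m n)"

definition diff2 :: "(nat \<Rightarrow> nat \<Rightarrow> real) \<Rightarrow> nat \<Rightarrow> nat \<Rightarrow> real" where
  "diff2 u = (\<lambda>m n. u m (n + 1) - u m n)"

definition joint_completely_monotone :: "(nat \<Rightarrow> nat \<Rightarrow> real) \<Rightarrow> bool" where
  "joint_completely_monotone u \<longleftrightarrow>
    (\<forall>i j m n. (-1) ^ (i + j) * (diff1 ^^ i) ((diff2 ^^ j) u) m n \<ge> 0)"

end

theory Submission
  imports Defs "HOL-Analysis.Summation_Tests" "HOL-Analysis.Infinite_Products"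
begin

text \<open>
  Write \<open>h = b / a\<close>, so that \<open>u m n = 1 / (a m * (h m + n))\<close>. Up to the sign \<open>(-1) ^ j\<close>, the \<open>j\<close>-th difference in \<open>n\<close>
  is \<open>j! / (a m * \<Prod>k\<le>j. h m + n + k)\<close>, so joint complete monotonicity says that these are completely
  monotone sequences in \<open>m\<close>. If \<open>b\<^sub>1 \<le> a\<^sub>1 \<le> b\<^sub>2\<close>, each \<open>b + t * a\<close> with \<open>t \<ge> 0\<close> has real roots
  \<open>- r\<^sub>1\<close>, \<open>- r\<^sub>2\<close> with \<open>0 < r\<^sub>1 \<le> a\<^sub>1\<close>, and
  \<open>(x + a\<^sub>1) / ((x + r\<^sub>1) * (x + r\<^sub>2)) = 1 / (x + r\<^sub>2) * (1 + (a\<^sub>1 - r\<^sub>1) / (x + r\<^sub>1))\<close> is completely monotone;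
  so are products of such functions. Conversely, completely monotone sequences are log-convex, and log-convexity
  at \<open>m = 0\<close> for all \<open>j\<close> and \<open>n\<close> forces \<open>h 0 + h 2 \<le> 2 * h 1\<close>. This second difference has the sign of
  \<open>(a\<^sub>1 - b\<^sub>1) * (a\<^sub>1 - b\<^sub>2)\<close>, which is positive if \<open>1 / a\<^sub>1 > 1 / b\<^sub>1 + 1 / b\<^sub>2\<close>.
\<close>

section \<open>Completely monotone sequences and their closure properties\<close>

definition nabla :: "(nat \<Rightarrow> real) \<Rightarrow> nat \<Rightarrow> real" where
  "nabla f = (\<lambda>m. f m - f (Suc m))"

text \<open>The sign built into \<open>nabla\<close> absorbs the usual factor
  \<open>(-1) ^ i\<close>.\<close>

definition completely_monotone :: "(nat \<Rightarrow> real) \<Rightarrow> bool" where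
  "completely_monotone f \<longleftrightarrow> (\<forall>i m. 0 \<le> (nabla ^^ i) f m)"

lemma nabla_funpow_add:
  "(nabla ^^ i) (\<lambda>m. f m + g m) = (\<lambda>m. (nabla ^^ i) f m + (nabla ^^ i) g m)"
  by (induction i) (auto simp: nabla_def)

lemma nabla_funpow_cmult: "(nabla ^^ i) (\<lambda>m. c * f m) = (\<lambda>m. c * (nabla ^^ i) f m)"
  by (induction i) (auto simp: nabla_def algebra_simps)

lemma nabla_funpow_shift: "(nabla ^^ i) (\<lambda>m. f (Suc m)) = (\<lambda>m. (nabla ^^ i) f (Suc m))"
  by (induction i) (auto simp: nabla_def)

lemma completely_monotone_nabla: "completely_monotone f \<Longrightarrow> completely_monotone (nabla f)"
  unfolding completely_monotone_def
  by (metis comp_apply funpow_Suc_right)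

lemma completely_monotone_shift: "completely_monotone f \<Longrightarrow> completely_monotone (\<lambda>m. f (Suc m))"
  by (simp add: completely_monotone_def nabla_funpow_shift)

lemma completely_monotone_add:
  "completely_monotone f \<Longrightarrow> completely_monotone g \<Longrightarrow> completely_monotone (\<lambda>m. f m + g m)"
  by (simp add: completely_monotone_def nabla_funpow_add)

lemma completely_monotone_cmult:
  "0 \<le> c \<Longrightarrow> completely_monotone f \<Longrightarrow> completely_monotone (\<lambda>m. c * f m)"
  by (simp add: completely_monotone_def nabla_funpow_cmult)

lemma completely_monotone_const:
  assumes "0 \<le> c" shows "completely_monotone (\<lambda>m. c)"
proof -
  have "(nabla ^^ i) (\<lambda>m. c) = (\<lambda>m. if i = 0 then c else 0)" for i
    by (induction i) (auto simp: nabla_def)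
  with assms show ?thesis
    by (simp add: completely_monotone_def)
qed

text \<open>The discrete Leibniz rule splits the difference of a product into two products of
  completely monotone sequences; the induction on the order therefore generalises both
  factors.\<close>

lemma completely_monotone_mult:
  assumes "completely_monotone f" "completely_monotone g"
  shows "completely_monotone (\<lambda>m. f m * g m)"
proof -
  have "0 \<le> (nabla ^^ i) (\<lambda>m. f m * g m) m" for i m
    using assms
  proof (induction i arbitrary: f g)
    case 0
    then have "0 \<le> (nabla ^^ 0) f m" "0 \<le> (nabla ^^ 0) g m"
      unfolding completely_monotone_def by blast+
    then show ?case by simp
  next
    case (Suc i)
    have "nabla (\<lambda>m. f m * g m) = (\<lambda>m. nabla f m * g m + f (Suc m) * nabla g m)"
      by (auto simp: nabla_def algebra_simps)
    with Suc show ?case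
      by (simp add: funpow_Suc_right nabla_funpow_add completely_monotone_nabla
          completely_monotone_shift del: funpow.simps)
  qed
  then show ?thesis
    by (simp add: completely_monotone_def)
qed

lemma completely_monotone_prod:
  "(\<And>k. k \<in> K \<Longrightarrow> completely_monotone (f k)) \<Longrightarrow> completely_monotone (\<lambda>m. \<Prod>k\<in>K. f k m)"
  by (induction K rule: infinite_finite_induct)
    (simp_all add: completely_monotone_const completely_monotone_mult)

lemma nabla_funpow_inverse_linear:
  assumes "0 < r"
  shows "(nabla ^^ i) (\<lambda>m. 1 / (r + real m)) = (\<lambda>m. fact i / pochhammer (r + real m) (Suc i))"
proof (induction i)
  case 0
  show ?case by simp
next
  case (Suc i)
  have "fact i / pochhammer (r + real m) (Suc i) - fact i / pochhammer (r + real (Suc m)) (Suc i)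
      = fact (Suc i) / pochhammer (r + real m) (Suc (Suc i))" for m
  proof -
    define x where "x = r + real m"
    \<comment> \<open>The factor shared by both Pochhammer symbols; what remains is the difference
      of \<open>1 / x\<close> and \<open>1 / (x + 1 + real i)\<close>.\<close>
    define p where "p = pochhammer (x + 1) i"
    have pos: "0 < x" "0 < x + 1 + real i" "0 < p"
      using assms by (auto simp: x_def p_def intro: pochhammer_pos)
    have "pochhammer x (Suc i) = x * p"
      by (simp add: pochhammer_rec p_def)
    moreover have "pochhammer (x + 1) (Suc i) = p * (x + 1 + real i)"
      by (simp add: pochhammer_Suc p_def)
    moreover have "pochhammer x (Suc (Suc i)) = x * (p * (x + 1 + real i))"
      by (simp add: pochhammer_rec[of x "Suc i"] pochhammer_Suc[of "x + 1" i] p_def)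
    moreover have "fact i / (x * p) - fact i / (p * (x + 1 + real i))
        = fact (Suc i) / (x * (p * (x + 1 + real i)))"
      using pos by (simp add: divide_simps) (simp add: algebra_simps)
    moreover have "r + real (Suc m) = x + 1"
      by (simp add: x_def)
    ultimately show ?thesis
      by (simp del: of_nat_Suc flip: x_def)
  qed
  with Suc show ?case
    by (simp add: nabla_def)
qed

lemma completely_monotone_inverse_linear:
  "0 < r \<Longrightarrow> completely_monotone (\<lambda>m. 1 / (r + real m))"
  by (simp add: completely_monotone_def nabla_funpow_inverse_linear pochhammer_pos
      less_imp_le add_pos_nonneg del: pochhammer_Suc)

section \<open>Reduction of joint complete monotonicity to one variable\<close>

lemma joint_completely_monotone_iff:
  "joint_completely_monotone u \<longleftrightarrow> (\<forall>j n. completely_monotone (\<lambda>m. (nabla ^^ j) (u m) n))"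
proof -
  have d2: "(diff2 ^^ j) u = (\<lambda>m n. (-1) ^ j * (nabla ^^ j) (u m) n)" for j
    by (induction j) (auto simp: diff2_def nabla_def algebra_simps)
  have d1: "(diff1 ^^ i) v = (\<lambda>m n. (-1) ^ i * (nabla ^^ i) (\<lambda>m. v m n) m)" for i v
    by (induction i) (auto simp: diff1_def nabla_def algebra_simps)
  have "(-1) ^ (i + j) * (diff1 ^^ i) ((diff2 ^^ j) u) m n
      = (nabla ^^ i) (\<lambda>m. (nabla ^^ j) (u m) n) m" for i j m n
  proof -
    have "((-1) ^ i * (-1) ^ i :: real) = 1" for i :: nat
      by (simp flip: power_mult_distrib)
    then have "((-1) ^ (i + j) * ((-1) ^ i * (-1) ^ j) :: real) = 1"
      by (simp add: power_add ac_simps)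
    then show ?thesis
      by (simp add: d2 d1 nabla_funpow_cmult flip: mult.assoc)
  qed
  then show ?thesis
    by (auto simp: joint_completely_monotone_def completely_monotone_def)
qed

section \<open>Log-convexity of completely monotone sequences\<close>

text \<open>The weights of this Bernstein expansion are nonnegative if \<open>f\<close> is completely monotone.\<close>

lemma nabla_binomial_expansion:
  "f m = (\<Sum>k\<le>N. real (N choose k) * (nabla ^^ (N - k)) f (m + k))"
proof (induction N arbitrary: f)
  case 0
  show ?case by simp
next
  case (Suc N)
  let ?w = "\<lambda>k. (nabla ^^ (Suc N - k)) f (m + k)"
  have "f m = nabla f m + f (Suc m)"
    by (simp add: nabla_def)
  also have "nabla f m = (\<Sum>k\<le>N. real (N choose k) * ?w k)"
    by (subst Suc[of "nabla f"], intro sum.cong)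
      (auto simp: funpow_Suc_right Suc_diff_le simp del: funpow.simps)
  \<comment> \<open>The shifted sum may run up to \<open>N\<close> because
    \<open>N choose Suc N\<close> vanishes; Pascal's rule then merges it with the sum for
    \<open>f (Suc m)\<close>.\<close>
  also have "\<dots> = ?w 0 + (\<Sum>k\<le>N. real (N choose Suc k) * ?w (Suc k))"
    using sum.atMost_Suc_shift[of "\<lambda>k. real (N choose k) * ?w k" N]
    by (simp add: binomial_eq_0)
  also have "f (Suc m) = (\<Sum>k\<le>N. real (N choose k) * ?w (Suc k))"
    using Suc[of "\<lambda>m. f (Suc m)"] by (simp add: nabla_funpow_shift)
  finally have "f m = ?w 0 + ((\<Sum>k\<le>N. real (N choose Suc k) * ?w (Suc k))
      + (\<Sum>k\<le>N. real (N choose k) * ?w (Suc k)))"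
    by simp
  also have "\<dots> = ?w 0 + (\<Sum>k\<le>N. real (Suc N choose Suc k) * ?w (Suc k))"
    by (simp add: sum.distrib[symmetric] algebra_simps)
  also have "\<dots> = (\<Sum>k\<le>Suc N. real (Suc N choose k) * ?w k)"
    by (subst sum.atMost_Suc_shift) simp
  finally show ?case .
qed

text \<open>Cauchy--Schwarz for the discrete probability weights of the Bernstein expansion; the error
  term in \<open>f 1\<close> disappears as \<open>N\<close> grows.\<close>

lemma completely_monotone_log_convex_approx:
  fixes N :: nat
  assumes f: "completely_monotone f" and f0: "0 < f 0"
  defines "M \<equiv> real N"
  shows "(M + 2) * (f 1)\<^sup>2 \<le> f 0 * ((M + 1) * f 2 + f 1)"
proof -
  define L where "L = M + 2"
  \<comment> \<open>Expanding \<open>f 0\<close>, \<open>f 1\<close>, \<open>f 2\<close> to orders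
    \<open>N + 2\<close>, \<open>N + 1\<close>, \<open>N\<close> makes the same differences
    \<open>w\<close> appear in all three. Binomial absorption then turns \<open>f 1\<close> and
    \<open>f 2\<close>, up to scaling, into the first two factorial moments of the weights
    \<open>W\<close>.\<close>
  define w where "w k = (nabla ^^ (N + 2 - k)) f k" for k
  define W where "W k = real ((N + 2) choose k) * w k" for k
  have L: "0 < L"
    by (simp add: L_def M_def)
  have L_Suc: "L = real (Suc (Suc N))"
    by (simp add: L_def M_def)
  have W: "0 \<le> W k" for k
    using f by (simp add: W_def w_def completely_monotone_def)
  have e0: "f 0 = (\<Sum>k\<le>N + 2. W k)"
    using nabla_binomial_expansion[of f 0 "N + 2"] by (simp add: W_def w_def)
  have abs1: "real (Suc k) * real (Suc n choose Suc k) = real (Suc n) * real (n choose k)" for n k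
    unfolding of_nat_mult[symmetric] by (simp only: Suc_times_binomial_eq mult.commute)
  have "f 1 = (\<Sum>k\<le>N + 1. real ((N + 1) choose k) * w (Suc k))"
    using nabla_binomial_expansion[of f 1 "N + 1"] by (simp add: w_def)
  then have "L * f 1 = (\<Sum>k\<le>N + 1. real (Suc k) * W (Suc k))"
    using abs1[of _ "N + 1"]
    by (simp add: sum_distrib_left W_def L_Suc mult.assoc[symmetric]
        del: of_nat_Suc binomial_Suc_Suc sum.atMost_Suc)
  also have "\<dots> = (\<Sum>k\<le>N + 2. real k * W k)"
    using sum.atMost_Suc_shift[of "\<lambda>k. real k * W k" "N + 1"] by simp
  finally have e1: "L * f 1 = (\<Sum>k\<le>N + 2. real k * W k)" .
  have f2: "f 2 = (\<Sum>k\<le>N. real (N choose k) * w (Suc (Suc k)))"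
    using nabla_binomial_expansion[of f 2 N] by (simp add: w_def numeral_2_eq_2)
  have "L * (M + 1) * f 2 = (\<Sum>k\<le>N. real (Suc (Suc k)) * real (Suc k) * W (Suc (Suc k)))"
  proof -
    have "real (Suc (Suc k)) * real (Suc k) * real (Suc (Suc N) choose Suc (Suc k))
        = real (Suc (Suc N)) * real (Suc N) * real (N choose k)" for k
      using abs1[of "Suc k" "Suc N"] abs1[of k N] by (metis mult.assoc mult.commute)
    moreover have "L * (M + 1) = real (Suc (Suc N)) * real (Suc N)"
      by (simp add: L_Suc M_def add.commute)
    ultimately show ?thesis
      by (simp add: f2 sum_distrib_left W_def mult.assoc[symmetric]
          del: of_nat_Suc binomial_Suc_Suc)
  qed
  also have "\<dots> = (\<Sum>k\<le>N + 2. real k * (real k - 1) * W k)"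
    using sum.atMost_Suc_shift[of "\<lambda>k. real k * (real k - 1) * W k" "N + 1"]
      sum.atMost_Suc_shift[of "\<lambda>k. real (Suc k) * real k * W (Suc k)" N] by simp
  finally have e2: "L * (M + 1) * f 2 = (\<Sum>k\<le>N + 2. real k * (real k - 1) * W k)" .
  \<comment> \<open>Nonnegative variance of \<open>k\<close> under \<open>W\<close>, whose mean is
    \<open>L * f 1 / f 0\<close>, with denominators cleared.\<close>
  have "0 \<le> (\<Sum>k\<le>N + 2. (f 0 * real k - L * f 1)\<^sup>2 * W k)"
    using W by (intro sum_nonneg) simp
  also have "\<dots> = (\<Sum>k\<le>N + 2. (f 0)\<^sup>2 * (real k * (real k - 1) * W k)
      + ((f 0)\<^sup>2 - 2 * f 0 * (L * f 1)) * (real k * W k) + (L * f 1)\<^sup>2 * W k)"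
    by (intro sum.cong) (auto simp: power2_eq_square algebra_simps)
  also have "\<dots> = (f 0)\<^sup>2 * (L * (M + 1) * f 2)
      + ((f 0)\<^sup>2 - 2 * f 0 * (L * f 1)) * (L * f 1) + (L * f 1)\<^sup>2 * f 0"
    by (simp only: sum.distrib sum_distrib_left[symmetric] e0 e1 e2)
  also have "\<dots> = (L * f 0) * (f 0 * ((M + 1) * f 2 + f 1) - L * (f 1)\<^sup>2)"
    by (simp add: power2_eq_square algebra_simps)
  finally have "0 \<le> f 0 * ((M + 1) * f 2 + f 1) - L * (f 1)\<^sup>2"
    using mult_pos_pos[OF L f0] by (simp only: zero_le_mult_iff) linarith
  then show ?thesis
    by (simp add: L_def)
qed

lemma completely_monotone_log_convex:
  assumes "completely_monotone f" "0 < f 0"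
  shows "(f 1)\<^sup>2 \<le> f 0 * f 2"
proof (rule ccontr)
  assume "\<not> ?thesis"
  then have d: "0 < (f 1)\<^sup>2 - f 0 * f 2" by simp
  \<comment> \<open>The approximate inequality bounds the right-hand side by
    \<open>f 0 * f 1 + f 0 * f 2 - 2 * (f 1)\<^sup>2\<close>, which is at most
    \<open>f 0 * f 1\<close> under the assumption \<open>d\<close>.\<close>
  obtain N where "f 0 * f 1 < real N * ((f 1)\<^sup>2 - f 0 * f 2)"
    using reals_Archimedean3[OF d] by blast
  moreover have "(real N + 2) * (f 1)\<^sup>2 \<le> f 0 * ((real N + 1) * f 2 + f 1)"
    by (rule completely_monotone_log_convex_approx[OF assms])
  ultimately show False
    using d by (simp add: algebra_simps) (use zero_le_power2[of "f (Suc 0)"] in linarith)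
qed

section \<open>Growth of ratios of Pochhammer products\<close>

lemma shifted_harmonic_sum_unbounded:
  assumes "0 < x"
  shows "\<exists>j. B < (\<Sum>k\<le>j. 1 / (x + real k))"
proof (rule ccontr)
  assume "\<not> ?thesis"
  then have "sum (\<lambda>k. 1 / (x + real k)) {..j} \<le> B" for j
    by (simp add: not_less)
  then have "summable (\<lambda>k. 1 / (x + real k))"
    using assms by (intro bounded_imp_summable[where B = B]) auto
  \<comment> \<open>The factor \<open>x + 1\<close> makes these terms dominate the harmonic
    series.\<close>
  then have "summable (\<lambda>k. (x + 1) * (1 / (x + real k)))"
    by (rule summable_mult)
  then have "summable (\<lambda>k. inverse (real (Suc k)))"
  proof (rule summable_comparison_test')
    fix k :: nat
    have "x + real k \<le> (x + 1) * (1 + real k)"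
      using assms by (simp add: algebra_simps)
    then show "norm (inverse (real (Suc k))) \<le> (x + 1) * (1 / (x + real k))"
      using assms by (simp add: field_simps add_pos_nonneg)
  qed
  then show False
    using not_summable_harmonic[where 'a = real] summable_Suc_iff by blast
qed

lemma pochhammer_eq_prod: "pochhammer (x::real) (Suc j) = (\<Prod>k\<le>j. x + real k)"
  by (simp add: pochhammer_prod atLeast0AtMost lessThan_Suc_atMost atLeast0LessThan)

text \<open>For large \<open>n\<close> the ratio of the \<open>k\<close>-th factors is at least
  \<open>1 + D / 2 / (x + real k)\<close>, with \<open>D\<close> the second difference of the
  \<open>h\<close>'s and \<open>x = h1 + real n\<close>; the product of these bounds diverges with
  the harmonic series.\<close>

lemma pochhammer_product_ratio_unbounded:
  fixes h0 h1 h2 :: real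
  assumes pos: "0 < h0" "0 < h1" "0 < h2" and conv: "2 * h1 < h0 + h2"
  shows "\<exists>n j. B * (pochhammer (h1 + real n) (Suc j))\<^sup>2
    < pochhammer (h0 + real n) (Suc j) * pochhammer (h2 + real n) (Suc j)"
proof -
  define D where "D = h0 + h2 - 2 * h1"
  have D: "0 < D" using conv by (simp add: D_def)
  \<comment> \<open>One half of \<open>D\<close> is kept for the growth of the product; the other
    half, times \<open>n\<close>, outweighs the constants in the factorwise comparison.\<close>
  obtain n where n: "D * h1 / 2 + h1\<^sup>2 - h0 * h2 < real n * (D / 2)"
    using reals_Archimedean3[OF half_gt_zero[OF D]] by blast
  define x where "x = h1 + real n"
  have x: "0 < x" using pos by (simp add: x_def)
  obtain j where j: "2 * B / D < (\<Sum>k\<le>j. 1 / (x + real k))"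
    using shifted_harmonic_sum_unbounded[OF x] by blast
  have "B < D / 2 * (\<Sum>k\<le>j. 1 / (x + real k))"
    using j D by (simp add: field_simps)
  also have "\<dots> = (\<Sum>k\<le>j. D / 2 / (x + real k))"
    by (simp add: sum_distrib_left)
  also have "\<dots> \<le> (\<Prod>k\<le>j. 1 + D / 2 / (x + real k))"
    using D x by (intro sum_le_prod) auto
  finally have B: "B < (\<Prod>k\<le>j. 1 + D / 2 / (x + real k))" .
  have xk: "0 < x + real k" for k
    using x by simp
  have "B * (pochhammer x (Suc j))\<^sup>2 < (\<Prod>k\<le>j. 1 + D / 2 / (x + real k)) * (pochhammer x (Suc j))\<^sup>2"
    using B x pochhammer_pos[OF x, of "Suc j"] by simp
  also have "\<dots> = (\<Prod>k\<le>j. (1 + D / 2 / (x + real k)) * (x + real k)\<^sup>2)"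
    by (simp only: pochhammer_eq_prod prod.distrib prod_power_distrib)
  also have "\<dots> = (\<Prod>k\<le>j. (x + real k)\<^sup>2 + D / 2 * (x + real k))"
  proof (intro prod.cong refl)
    have "(1 + c / y) * y\<^sup>2 = y\<^sup>2 + c * y" if "0 < y" for c y :: real
      using that by (simp add: field_simps power2_eq_square)
    then show "(1 + D / 2 / (x + real k)) * (x + real k)\<^sup>2 = (x + real k)\<^sup>2 + D / 2 * (x + real k)" for k
      using xk by blast
  qed
  also have "\<dots> \<le> (\<Prod>k\<le>j. (h0 + real n + real k) * (h2 + real n + real k))"
  proof (intro prod_mono conjI)
    fix k
    show "0 \<le> (x + real k)\<^sup>2 + D / 2 * (x + real k)"
      using D xk[of k] by simp
    have "(h0 + real n + real k) * (h2 + real n + real k)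
        - ((x + real k)\<^sup>2 + D / 2 * (x + real k))
        = real n * (D / 2) - (D * h1 / 2 + h1\<^sup>2 - h0 * h2) + D / 2 * real k"
      by (simp add: x_def D_def power2_eq_square field_simps)
    moreover have "0 \<le> D / 2 * real k" using D by simp
    ultimately show "(x + real k)\<^sup>2 + D / 2 * (x + real k)
        \<le> (h0 + real n + real k) * (h2 + real n + real k)"
      using n by linarith
  qed
  also have "\<dots> = pochhammer (h0 + real n) (Suc j) * pochhammer (h2 + real n) (Suc j)"
    by (simp only: pochhammer_eq_prod prod.distrib)
  finally show ?thesis
    unfolding x_def by blast
qed

section \<open>Complete monotonicity of linear over quadratic functions\<close>

lemma completely_monotone_linear_div_quadratic:
  fixes a\<^sub>1 p q :: real
  assumes "0 < a\<^sub>1" "0 < p" "0 < q" and neg: "a\<^sub>1\<^sup>2 - p * a\<^sub>1 + q \<le> 0"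
  shows "completely_monotone (\<lambda>m. (real m + a\<^sub>1) / ((real m)\<^sup>2 + p * real m + q))"
proof -
  define s where "s = sqrt (p\<^sup>2 - 4 * q)"
  define r\<^sub>1 where "r\<^sub>1 = (p - s) / 2"
  define r\<^sub>2 where "r\<^sub>2 = (p + s) / 2"
  \<comment> \<open>By \<open>neg\<close> the quadratic is nonpositive at
    \<open>- a\<^sub>1\<close>. Completing the square yields both real roots and
    \<open>r\<^sub>1 \<le> a\<^sub>1\<close>.\<close>
  have le: "(p - 2 * a\<^sub>1)\<^sup>2 \<le> p\<^sup>2 - 4 * q"
    using neg by (simp add: power2_eq_square algebra_simps)
  then have disc: "0 \<le> p\<^sup>2 - 4 * q"
    by (rule order_trans[rotated]) simp
  have s2: "s\<^sup>2 = p\<^sup>2 - 4 * q"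
    using disc by (simp add: s_def)
  have "0 \<le> s" using disc by (simp add: s_def)
  have "p - 2 * a\<^sub>1 \<le> s"
    unfolding s_def by (rule real_le_rsqrt[OF le])
  then have r1a: "r\<^sub>1 \<le> a\<^sub>1" by (simp add: r\<^sub>1_def)
  have "s\<^sup>2 < p\<^sup>2" using s2 assms by simp
  then have "s < p" using assms by (simp add: power_less_imp_less_base)
  then have r: "0 < r\<^sub>1" "0 < r\<^sub>2"
    using \<open>0 \<le> s\<close> assms by (auto simp: r\<^sub>1_def r\<^sub>2_def)
  have pq: "p = r\<^sub>1 + r\<^sub>2" "q = r\<^sub>1 * r\<^sub>2"
    using s2 by (auto simp: r\<^sub>1_def r\<^sub>2_def power2_eq_square field_simps)
  have "(real m + a\<^sub>1) / ((real m)\<^sup>2 + p * real m + q)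
      = 1 / (r\<^sub>2 + real m) * (1 + (a\<^sub>1 - r\<^sub>1) * (1 / (r\<^sub>1 + real m)))" for m
  proof -
    have "(real m)\<^sup>2 + p * real m + q = (r\<^sub>1 + real m) * (r\<^sub>2 + real m)"
      by (simp add: pq power2_eq_square algebra_simps)
    moreover have "r\<^sub>1 + real m \<noteq> 0" "r\<^sub>2 + real m \<noteq> 0"
      using r by (simp_all add: add_pos_nonneg less_imp_neq[symmetric])
    ultimately show ?thesis
      by (simp add: field_simps)
  qed
  then show ?thesis
    using r r1a
    by (simp add: completely_monotone_mult completely_monotone_add completely_monotone_const
        completely_monotone_cmult completely_monotone_inverse_linear
        del: times_divide_eq_left times_divide_eq_right)
qed

section \<open>Sufficiency of the interlacing condition and necessity of the reciprocal
  inequality\<close>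

theorem theorem3p6:
  fixes a\<^sub>0 a\<^sub>1 b\<^sub>0 b\<^sub>1 b\<^sub>2 :: real
    and a b :: "real \<Rightarrow> real"
  assumes "a\<^sub>0 > 0" and "a\<^sub>1 > 0" and "b\<^sub>0 > 0" and "b\<^sub>1 > 0" and "b\<^sub>2 > 0"
    and "\<And>x. x \<ge> 0 \<Longrightarrow> a x = a\<^sub>0 * (x + a\<^sub>1)"
    and "\<And>x. x \<ge> 0 \<Longrightarrow> b x = b\<^sub>0 * (x + b\<^sub>1) * (x + b\<^sub>2)"
  shows "(b\<^sub>1 \<le> a\<^sub>1 \<and> a\<^sub>1 \<le> b\<^sub>2 \<longrightarrow>
            joint_completely_monotone (\<lambda>m n. 1 / (b (real m) + a (real m) * real n)))
       \<and> (joint_completely_monotone (\<lambda>m n. 1 / (b (real m) + a (real m) * real n)) \<longrightarrow>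
            1 / a\<^sub>1 \<le> 1 / b\<^sub>1 + 1 / b\<^sub>2)"
proof -
  define h where "h m = b (real m) / a (real m)" for m
  have a_eq: "a (real m) = a\<^sub>0 * (real m + a\<^sub>1)" for m
    using assms(6) by simp
  have b_eq: "b (real m) = b\<^sub>0 * (real m + b\<^sub>1) * (real m + b\<^sub>2)" for m
    using assms(7) by simp
  have a_pos: "0 < a (real m)" for m
    using assms(1,2) by (simp add: a_eq add_nonneg_pos)
  have b_pos: "0 < b (real m)" for m
    using assms(3-5) by (simp add: b_eq add_nonneg_pos)
  have h_pos: "0 < h m" for m
    using a_pos b_pos by (simp add: h_def)
  have nabla_u: "(nabla ^^ j) (\<lambda>n. 1 / (b (real m) + a (real m) * real n)) n
      = 1 / a (real m) * (fact j / pochhammer (h m + real n) (Suc j))" for j m n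
  proof -
    have "(\<lambda>n. 1 / (b (real m) + a (real m) * real n)) = (\<lambda>n. 1 / a (real m) * (1 / (h m + real n)))"
      using a_pos[of m] by (auto simp: h_def field_simps)
    then show ?thesis
      by (simp only: nabla_funpow_cmult nabla_funpow_inverse_linear[OF h_pos])
  qed
  have jcm_iff: "joint_completely_monotone (\<lambda>m n. 1 / (b (real m) + a (real m) * real n)) \<longleftrightarrow>
      (\<forall>j n. completely_monotone
        (\<lambda>m. 1 / a (real m) * (fact j / pochhammer (h m + real n) (Suc j))))"
    by (simp only: joint_completely_monotone_iff nabla_u)
  show ?thesis
  proof (intro conjI impI)
    assume ab: "b\<^sub>1 \<le> a\<^sub>1 \<and> a\<^sub>1 \<le> b\<^sub>2"
    have cm_h: "completely_monotone (\<lambda>m. 1 / (h m + t))" if t: "0 \<le> t" for t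
    proof -
      \<comment> \<open>Normalises \<open>b + t * a\<close> to \<open>b\<^sub>0\<close> times the
        monic quadratic with coefficients \<open>p\<close>, \<open>q\<close>.\<close>
      define \<tau> where "\<tau> = t * a\<^sub>0 / b\<^sub>0"
      have \<tau>: "0 \<le> \<tau>" using t assms by (simp add: \<tau>_def)
      define p where "p = b\<^sub>1 + b\<^sub>2 + \<tau>"
      define q where "q = b\<^sub>1 * b\<^sub>2 + \<tau> * a\<^sub>1"
      \<comment> \<open>The value at \<open>- a\<^sub>1\<close> is independent of
        \<open>\<tau>\<close>, since the added term \<open>\<tau> * (x + a\<^sub>1)\<close> vanishes
        there.\<close>
      have "a\<^sub>1\<^sup>2 - p * a\<^sub>1 + q = (a\<^sub>1 - b\<^sub>1) * (a\<^sub>1 - b\<^sub>2)"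
        by (simp add: p_def q_def power2_eq_square algebra_simps)
      also have "\<dots> \<le> 0"
        using ab by (simp add: mult_nonneg_nonpos)
      finally have "completely_monotone (\<lambda>m. (real m + a\<^sub>1) / ((real m)\<^sup>2 + p * real m + q))"
        using assms \<tau>
        by (intro completely_monotone_linear_div_quadratic) (auto simp: p_def q_def add_pos_nonneg)
      then have "completely_monotone
          (\<lambda>m. a\<^sub>0 / b\<^sub>0 * ((real m + a\<^sub>1) / ((real m)\<^sup>2 + p * real m + q)))"
        using assms by (intro completely_monotone_cmult) auto
      moreover have "1 / (h m + t) = a\<^sub>0 / b\<^sub>0 * ((real m + a\<^sub>1) / ((real m)\<^sup>2 + p * real m + q))" for m
      proof -
        have "1 / (h m + t) = a (real m) / (b (real m) + t * a (real m))"
          using a_pos[of m] by (simp add: h_def field_simps)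
        also have "b (real m) + t * a (real m) = b\<^sub>0 * ((real m)\<^sup>2 + p * real m + q)"
          using assms(3) by (simp add: a_eq b_eq p_def q_def \<tau>_def power2_eq_square field_simps)
        finally show ?thesis by (simp add: a_eq)
      qed
      ultimately show ?thesis by simp
    qed
    have cm_a: "completely_monotone (\<lambda>m. 1 / a (real m))"
      using completely_monotone_cmult[OF _ completely_monotone_inverse_linear, of "1 / a\<^sub>0" a\<^sub>1] assms
      by (simp add: a_eq add.commute)
    have "completely_monotone (\<lambda>m. 1 / a (real m) * (fact j / pochhammer (h m + real n) (Suc j)))"
      for j n
    proof -
      have "completely_monotone (\<lambda>m. \<Prod>k\<le>j. 1 / (h m + (real n + real k)))"
        by (intro completely_monotone_prod cm_h) simp
      moreover have "(\<Prod>k\<le>j. 1 / (h m + (real n + real k))) = 1 / pochhammer (h m + real n) (Suc j)" for m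
        by (simp add: pochhammer_eq_prod prod_dividef add.assoc)
      ultimately have "completely_monotone (\<lambda>m. fact j * (1 / pochhammer (h m + real n) (Suc j)))"
        by (intro completely_monotone_cmult) simp_all
      then have "completely_monotone
          (\<lambda>m. 1 / a (real m) * (fact j * (1 / pochhammer (h m + real n) (Suc j))))"
        by (rule completely_monotone_mult[OF cm_a])
      then show ?thesis by simp
    qed
    then show "joint_completely_monotone (\<lambda>m n. 1 / (b (real m) + a (real m) * real n))"
      by (simp add: jcm_iff)
  next
    assume "joint_completely_monotone (\<lambda>m n. 1 / (b (real m) + a (real m) * real n))"
    then have cm: "completely_monotone
        (\<lambda>m. 1 / a (real m) * (fact j / pochhammer (h m + real n) (Suc j)))" for j n
      by (simp only: jcm_iff)
    show "1 / a\<^sub>1 \<le> 1 / b\<^sub>1 + 1 / b\<^sub>2"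
    proof (rule ccontr)
      assume "\<not> ?thesis"
      then have gt: "1 / b\<^sub>1 + 1 / b\<^sub>2 < 1 / a\<^sub>1" by simp
      have "1 / b\<^sub>1 < 1 / a\<^sub>1" "1 / b\<^sub>2 < 1 / a\<^sub>1"
        using gt assms(4,5) by (smt (verit) zero_less_divide_1_iff)+
      then have lt: "a\<^sub>1 < b\<^sub>1" "a\<^sub>1 < b\<^sub>2"
        using assms by (auto simp: field_simps)
      \<comment> \<open>The remainder of \<open>(x + b\<^sub>1) * (x + b\<^sub>2)\<close> on
        division by \<open>x + a\<^sub>1\<close>. The quotient is affine, so the second difference
        of \<open>h\<close> comes from \<open>c / (x + a\<^sub>1)\<close> alone.\<close>
      define c where "c = (b\<^sub>1 - a\<^sub>1) * (b\<^sub>2 - a\<^sub>1)"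
      have c: "0 < c" using lt by (simp add: c_def)
      have h_eq: "h m = b\<^sub>0 / a\<^sub>0 * (real m + (b\<^sub>1 + b\<^sub>2 - a\<^sub>1) + c / (real m + a\<^sub>1))" for m
      proof -
        have "real m + a\<^sub>1 \<noteq> 0" using assms(2) by (simp add: add_nonneg_pos less_imp_neq[symmetric])
        then show ?thesis
          using assms(1) by (simp add: h_def a_eq b_eq c_def field_simps)
      qed
      have "h 0 + h 2 - 2 * h 1
          = b\<^sub>0 / a\<^sub>0 * c * (1 / a\<^sub>1 + 1 / (2 + a\<^sub>1) - 2 / (1 + a\<^sub>1))"
        by (simp add: h_eq algebra_simps)
      also have "1 / a\<^sub>1 + 1 / (2 + a\<^sub>1) - 2 / (1 + a\<^sub>1) = 2 / (a\<^sub>1 * (1 + a\<^sub>1) * (2 + a\<^sub>1))"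
        using assms(2) by (simp add: divide_simps) (simp add: algebra_simps)
      also have "b\<^sub>0 / a\<^sub>0 * c * \<dots> > 0"
        using assms c by simp
      finally have conv: "2 * h 1 < h 0 + h 2" by simp
      \<comment> \<open>Log-convexity at \<open>m = 0\<close> would bound
        \<open>P 0 * P 2 / (P 1)\<^sup>2\<close> by this constant, whatever \<open>n\<close> and
        \<open>j\<close>; the factorials cancel.\<close>
      define B where "B = (a 1)\<^sup>2 / (a 0 * a 2)"
      obtain n j where nj: "B * (pochhammer (h 1 + real n) (Suc j))\<^sup>2
          < pochhammer (h 0 + real n) (Suc j) * pochhammer (h 2 + real n) (Suc j)"
        using pochhammer_product_ratio_unbounded[OF h_pos h_pos h_pos conv] by blast
      define P where "P m = pochhammer (h m + real n) (Suc j)" for m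
      have P: "0 < P m" for m
        unfolding P_def using h_pos by (intro pochhammer_pos add_pos_nonneg) auto
      have A: "0 < a 0" "0 < a 1" "0 < a 2"
        using a_pos[of 0] a_pos[of 1] a_pos[of 2] by simp_all
      have "(1 / a 1 * (fact j / P 1))\<^sup>2 \<le> 1 / a 0 * (fact j / P 0) * (1 / a 2 * (fact j / P 2))"
        using completely_monotone_log_convex[OF cm[of j n]] P[of 0] A(1)
        by (simp add: P_def[symmetric])
      then have "P 0 * P 2 \<le> B * (P 1)\<^sup>2"
        using A P by (simp add: B_def field_simps power2_eq_square)
      with nj show False
        by (simp add: P_def)
    qed
  qed
qed

end
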